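(* Let $n\ge 1$ be an integer, let $p\in(0,1)$, and let $P$ be the Bernoulli product measure of parameter $p$ on $\Omega=\{0,1\}^n$. For any pair of increasing events $A,B\subset\Omega$, we have $$P(A\circ B)\le (P\otimes P)(A\boxtimes B),$$ where $P\otimes P$ is the product measure on $\Omega\times\Omega$.
   Context: The Bernoulli product measure $P$ of parameter $p$ on $\Omega=\{0,1\}^n$ is the one for which the $n$ coordinates are independent, each equal to $1$ with probability $p$ and to $0$ with probability $1-p$. The set $\Omega$ carries the product order: $x\le y$ if $x_i\le y_i$ for all $1\le i\le n$. A subset $A$ of $\Omega$ is increasing if $x\mapsto 1_A(x)$ is non-decreasing for this order. Witness: for $A\subset\Omega$ and $x\in A$, a subset $I$ of $\{1,\dots,n\}$ is a witness for $A$ in $x$ if every $y\in\Omega$ satisfying $y_i=x_i$ for all $i\in I$ belongs to $A$. Disjoint occurrence: $A\circ B$ is the set of $u\in A\cap B$ for which there exist $I,J\subset\{1,\dots,n\}$ with $I\cap J=\varnothing$ such that $I$ is a witness for $A$ in $u$ and $J$ is a witness for $B$ in $u$. Disjoint testimony: $A\boxtimes B$ is the set of pairs $(x,y)\in A\times B$ for which there exist $I,J\subset\{1,\dots,n\}$ with $I\cap J=\varnothing$ such that $I$ is a witness for $A$ in $x$ and $J$ is a witness for $B$ in $y$. *)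

theory Defs
  imports "HOL-Probability.Probability"
begin

text \<open>
  The elements 0 and 1 of the two-point set are represented by \<^const>\<open>False\<close> and \<^const>\<open>True\<close>.
  Points of the cube are extensional functions: they all take the value \<^term>\<open>undefined\<close>
  outside \<open>{1..n}\<close>, so equality and the pointwise order \<open>\<le>\<close> of functions, restricted to the
  cube, are the coordinatewise equality and the product order.
\<close>

definition cube :: "nat \<Rightarrow> (nat \<Rightarrow> bool) set" where
  "cube n = {1..n} \<rightarrow>\<^sub>E UNIV"

definition bernoulli_product :: "nat \<Rightarrow> real \<Rightarrow> (nat \<Rightarrow> bool) measure" where
  "bernoulli_product n p = (\<Pi>\<^sub>M i\<in>{1..n}. measure_pmf (bernoulli_pmf p))"

definition increasing_event :: "nat \<Rightarrow> (nat \<Rightarrow> bool) set \<Rightarrow> bool" where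
  "increasing_event n A \<longleftrightarrow> A \<subseteq> cube n \<and> mono_on (cube n) (indicat_real A)"

definition witness :: "nat \<Rightarrow> (nat \<Rightarrow> bool) set \<Rightarrow> (nat \<Rightarrow> bool) \<Rightarrow> nat set \<Rightarrow> bool" where
  "witness n A x I \<longleftrightarrow>
     I \<subseteq> {1..n} \<and> (\<forall>y\<in>cube n. (\<forall>i\<in>I. y i = x i) \<longrightarrow> y \<in> A)"

definition disjoint_occurrence ::
    "nat \<Rightarrow> (nat \<Rightarrow> bool) set \<Rightarrow> (nat \<Rightarrow> bool) set \<Rightarrow> (nat \<Rightarrow> bool) set" where
  "disjoint_occurrence n A B =
     {u \<in> A \<inter> B. \<exists>I J. I \<inter> J = {} \<and> witness n A u I \<and> witness n B u J}"

definition disjoint_testimony ::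
    "nat \<Rightarrow> (nat \<Rightarrow> bool) set \<Rightarrow> (nat \<Rightarrow> bool) set \<Rightarrow> ((nat \<Rightarrow> bool) \<times> (nat \<Rightarrow> bool)) set" where
  "disjoint_testimony n A B =
     {(x, y) \<in> A \<times> B. \<exists>I J. I \<inter> J = {} \<and> witness n A x I \<and> witness n B y J}"

text \<open>
  Every subset of the cube, and of its square, is measurable, so \<^const>\<open>measure\<close> never returns
  its default value 0 on the events considered here.
\<close>

lemma space_bernoulli_product: "space (bernoulli_product n p) = cube n"
  by (simp add: bernoulli_product_def cube_def space_PiM)

lemma finite_cube: "finite (cube n)"
  by (simp add: cube_def finite_PiE)

lemma singleton_sets_bernoulli_product:
  assumes "x \<in> cube n"
  shows "{x} \<in> sets (bernoulli_product n p)"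
proof -
  have "x \<in> extensional {1..n}"
    using assms by (simp add: cube_def PiE_def)
  then have eq: "Pi\<^sub>E {1..n} (\<lambda>i. {x i}) = {x}"
    by (simp add: PiE_singleton)
  have "Pi\<^sub>E {1..n} (\<lambda>i. {x i}) \<in> sets (bernoulli_product n p)"
    unfolding bernoulli_product_def by (rule sets_PiM_I_finite) auto
  then show ?thesis by (simp only: eq)
qed

lemma sets_bernoulli_product: "sets (bernoulli_product n p) = Pow (cube n)"
proof
  show "sets (bernoulli_product n p) \<subseteq> Pow (cube n)"
    using sets.space_closed[of "bernoulli_product n p"] by (simp add: space_bernoulli_product)
  show "Pow (cube n) \<subseteq> sets (bernoulli_product n p)"
  proof
    fix A assume "A \<in> Pow (cube n)"
    then have A: "A \<subseteq> cube n" by simp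
    then have "(\<Union>x\<in>A. {x}) \<in> sets (bernoulli_product n p)"
      using finite_subset[OF A finite_cube]
      by (intro sets.finite_UN) (auto intro: singleton_sets_bernoulli_product)
    then show "A \<in> sets (bernoulli_product n p)" by simp
  qed
qed

lemma sets_bernoulli_product_pair:
  "sets (bernoulli_product n p \<Otimes>\<^sub>M bernoulli_product n p) = Pow (cube n \<times> cube n)"
proof
  show "sets (bernoulli_product n p \<Otimes>\<^sub>M bernoulli_product n p) \<subseteq> Pow (cube n \<times> cube n)"
    using sets.space_closed[of "bernoulli_product n p \<Otimes>\<^sub>M bernoulli_product n p"]
    by (simp add: space_bernoulli_product space_pair_measure)
  show "Pow (cube n \<times> cube n) \<subseteq> sets (bernoulli_product n p \<Otimes>\<^sub>M bernoulli_product n p)"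
  proof
    fix C assume "C \<in> Pow (cube n \<times> cube n)"
    then have C: "C \<subseteq> cube n \<times> cube n" by simp
    then have "(\<Union>z\<in>C. {fst z} \<times> {snd z}) \<in> sets (bernoulli_product n p \<Otimes>\<^sub>M bernoulli_product n p)"
      using finite_subset[OF C] finite_cube
      by (intro sets.finite_UN pair_measureI singleton_sets_bernoulli_product) auto
    then show "C \<in> sets (bernoulli_product n p \<Otimes>\<^sub>M bernoulli_product n p)" by simp
  qed
qed

end

theory Submission
  imports Defs
begin

text \<open>
  The left-hand side is the probability that \<open>(u, u)\<close> satisfies a certain relation, the right-hand
  side the probability that a pair \<open>(x, y)\<close> of independent points satisfies the same relation.
  Indeed, for increasing events a witness can be shrunk to the coordinates where the point is 1
  (\<open>witness_restrict_to_ones\<close>), so both \<open>u \<in> A \<circ> B\<close> and \<open>(x, y) \<in> A \<box> B\<close> are instances of the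
  relation \<open>jointly_open F x y\<close>: some pair \<open>(I, J)\<close> of a fixed family \<open>F\<close> of pairs of disjoint sets
  has \<open>x = 1\<close> on \<open>I\<close> and \<open>y = 1\<close> on \<open>J\<close>.

  It remains to see that decoupling \<open>x\<close> from \<open>y\<close> makes this relation more likely, and this can be
  done one coordinate at a time. With the other coordinates frozen, let \<open>f a b\<close> be the indicator
  of the relation when coordinate \<open>i\<close> of \<open>x\<close> is \<open>a\<close> and that of \<open>y\<close> is \<open>b\<close>. As \<open>i\<close> belongs to at most
  one of \<open>I\<close> and \<open>J\<close>, the two ones of \<open>f 1 1\<close> are never needed together; as \<open>f\<close> is monotone, it follows
  that
  \<open>f 1 1 + f 0 0 \<le> f 1 0 + f 0 1\<close> (\<open>jointly_open_exchange\<close>). For \<open>U\<close>, \<open>V\<close> independent and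
  identically distributed, averaging \<open>f U U + f V V \<le> f U V + f V U\<close> gives
  \<open>E (f U U) \<le> E (f U V)\<close>. Induction on the number of coordinates turns this into
  \<open>product_sum_diagonal_le\<close>, which holds for arbitrary product distributions with finitely many
  values in each coordinate.
\<close>

section \<open>Decoupling the coordinates of a product distribution\<close>

text \<open>
  This is the case of one coordinate: \<open>f U U + f V V \<le> f U V + f V U\<close> is averaged over an
  independent pair \<open>(U, V)\<close> of distribution \<open>w\<close>.
\<close>

lemma weighted_sum_diagonal_le:
  fixes w :: "'b \<Rightarrow> real" and f :: "'b \<Rightarrow> 'b \<Rightarrow> real"
  assumes nonneg: "\<And>a. a \<in> X \<Longrightarrow> 0 \<le> w a"
    and total: "sum w X = 1"
    and exchange: "\<And>a b. a \<in> X \<Longrightarrow> b \<in> X \<Longrightarrow> f a a + f b b \<le> f a b + f b a"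
  shows "(\<Sum>a\<in>X. w a * f a a) \<le> (\<Sum>a\<in>X. \<Sum>b\<in>X. w a * w b * f a b)"
proof -
  let ?D = "\<Sum>a\<in>X. w a * f a a" and ?S = "\<Sum>a\<in>X. \<Sum>b\<in>X. w a * w b * f a b"
  have D1: "(\<Sum>a\<in>X. \<Sum>b\<in>X. w a * w b * f a a) = ?D"
  proof (rule sum.cong[OF refl])
    fix a
    have "(\<Sum>b\<in>X. w a * w b * f a a) = sum w X * (w a * f a a)"
      unfolding sum_distrib_right by (simp add: ac_simps)
    then show "(\<Sum>b\<in>X. w a * w b * f a a) = w a * f a a"
      by (simp add: total)
  qed
  have D2: "(\<Sum>a\<in>X. \<Sum>b\<in>X. w a * w b * f b b) = ?D"
    by (subst sum.swap) (simp only: D1[symmetric] mult.commute mult.left_commute)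
  have S2: "(\<Sum>a\<in>X. \<Sum>b\<in>X. w a * w b * f b a) = ?S"
    by (subst sum.swap) (simp only: mult.commute mult.left_commute)
  have "(\<Sum>a\<in>X. \<Sum>b\<in>X. w a * w b * (f a a + f b b))
      \<le> (\<Sum>a\<in>X. \<Sum>b\<in>X. w a * w b * (f a b + f b a))"
    by (intro sum_mono mult_left_mono exchange mult_nonneg_nonneg nonneg)
  then have "?D + ?D \<le> ?S + ?S"
    by (simp only: distrib_left sum.distrib D1 D2 S2)
  then show ?thesis by simp
qed

lemma sum_PiE_insert:
  assumes "i \<notin> K"
  shows "(\<Sum>x\<in>PiE (insert i K) X. g x) = (\<Sum>a\<in>X i. \<Sum>x\<in>PiE K X. g (x(i := a)))"
proof -
  have "(\<Sum>x\<in>PiE (insert i K) X. g x) = (\<Sum>(a, x)\<in>X i \<times> PiE K X. g (x(i := a)))"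
    unfolding PiE_insert_eq using inj_combinator[OF assms, of X]
    by (subst sum.reindex) (auto simp: case_prod_unfold o_def)
  then show ?thesis by (simp add: sum.cartesian_product)
qed

lemma sum_PiE_insert_product_weight:
  fixes w :: "'i \<Rightarrow> 'b \<Rightarrow> real"
  assumes "finite K" "i \<notin> K"
  shows "(\<Sum>x\<in>PiE (insert i K) X. (\<Prod>j\<in>insert i K. w j (x j)) * g x)
       = (\<Sum>a\<in>X i. \<Sum>x\<in>PiE K X. w i a * (\<Prod>j\<in>K. w j (x j)) * g (x(i := a)))"
proof -
  have "(\<Prod>j\<in>insert i K. w j ((x(i := a)) j)) = w i a * (\<Prod>j\<in>K. w j (x j))" for x a
    using assms by (auto simp: prod.insert intro!: prod.cong)
  then show ?thesis by (simp only: sum_PiE_insert[OF assms(2)])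
qed

text \<open>
  The exchange hypothesis only compares points that agree outside one coordinate. In the induction
  step it passes to the functions in which coordinate \<open>i\<close> of both arguments has been set to the
  same value; after the induction hypothesis has decoupled the other coordinates, the
  one-coordinate inequality decouples coordinate \<open>i\<close>.
\<close>

lemma product_sum_diagonal_le:
  fixes w :: "'i \<Rightarrow> 'b \<Rightarrow> real" and f :: "('i \<Rightarrow> 'b) \<Rightarrow> ('i \<Rightarrow> 'b) \<Rightarrow> real"
  assumes "finite K"
    and nonneg: "\<And>i a. i \<in> K \<Longrightarrow> a \<in> X i \<Longrightarrow> 0 \<le> w i a"
    and total: "\<And>i. i \<in> K \<Longrightarrow> sum (w i) (X i) = 1"
    and exchange: "\<And>i a b x y. i \<in> K \<Longrightarrow> a \<in> X i \<Longrightarrow> b \<in> X i \<Longrightarrow>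
      f (x(i := a)) (y(i := a)) + f (x(i := b)) (y(i := b))
        \<le> f (x(i := a)) (y(i := b)) + f (x(i := b)) (y(i := a))"
  shows "(\<Sum>x\<in>PiE K X. (\<Prod>i\<in>K. w i (x i)) * f x x)
       \<le> (\<Sum>x\<in>PiE K X. \<Sum>y\<in>PiE K X. (\<Prod>i\<in>K. w i (x i)) * (\<Prod>i\<in>K. w i (y i)) * f x y)"
  using assms
proof (induction K arbitrary: f rule: finite_induct)
  case empty
  then show ?case by simp
next
  case (insert i K)
  define W where "W x = (\<Prod>j\<in>K. w j (x j))" for x
  have W_nonneg: "0 \<le> W x" if "x \<in> PiE K X" for x
    unfolding W_def using that by (intro prod_nonneg insert.prems(1)) (auto simp: PiE_mem)
  have IH: "(\<Sum>x\<in>PiE K X. W x * f (x(i := a)) (x(i := a)))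
      \<le> (\<Sum>x\<in>PiE K X. \<Sum>y\<in>PiE K X. W x * W y * f (x(i := a)) (y(i := a)))" for a
    unfolding W_def
  proof (rule insert.IH)
    fix j b c x y assume j: "j \<in> K" "b \<in> X j" "c \<in> X j"
    then have "j \<noteq> i" using insert.hyps by auto
    then have twist: "z(j := d, i := a) = z(i := a, j := d)" for z :: "'i \<Rightarrow> 'b" and d
      by (rule fun_upd_twist)
    then show "f (x(j := b, i := a)) (y(j := b, i := a)) + f (x(j := c, i := a)) (y(j := c, i := a))
        \<le> f (x(j := b, i := a)) (y(j := c, i := a)) + f (x(j := c, i := a)) (y(j := b, i := a))"
      unfolding twist using j by (intro insert.prems(3)) auto
  qed (use insert.prems in auto)
  have "(\<Sum>x\<in>PiE (insert i K) X. (\<Prod>j\<in>insert i K. w j (x j)) * f x x)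
      = (\<Sum>a\<in>X i. w i a * (\<Sum>x\<in>PiE K X. W x * f (x(i := a)) (x(i := a))))"
    unfolding sum_PiE_insert_product_weight[OF insert.hyps, where w = w] W_def
    by (simp only: sum_distrib_left mult.assoc)
  also have "\<dots> \<le> (\<Sum>a\<in>X i. w i a * (\<Sum>x\<in>PiE K X. \<Sum>y\<in>PiE K X.
      W x * W y * f (x(i := a)) (y(i := a))))"
    by (intro sum_mono mult_left_mono IH insert.prems(1)) auto
  also have "\<dots> = (\<Sum>a\<in>X i. \<Sum>x\<in>PiE K X. \<Sum>y\<in>PiE K X.
      W x * W y * (w i a * f (x(i := a)) (y(i := a))))"
    by (simp add: sum_distrib_left ac_simps)
  also have "\<dots> = (\<Sum>x\<in>PiE K X. \<Sum>y\<in>PiE K X. \<Sum>a\<in>X i.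
      W x * W y * (w i a * f (x(i := a)) (y(i := a))))"
    by (subst sum.swap) (intro sum.cong[OF refl] sum.swap)
  also have "\<dots> = (\<Sum>x\<in>PiE K X. \<Sum>y\<in>PiE K X.
      W x * W y * (\<Sum>a\<in>X i. w i a * f (x(i := a)) (y(i := a))))"
    by (simp only: sum_distrib_left)
  also have "\<dots> \<le> (\<Sum>x\<in>PiE K X. \<Sum>y\<in>PiE K X.
      W x * W y * (\<Sum>a\<in>X i. \<Sum>b\<in>X i. w i a * w i b * f (x(i := a)) (y(i := b))))"
    by (intro sum_mono mult_left_mono weighted_sum_diagonal_le mult_nonneg_nonneg W_nonneg
        insert.prems) auto
  also have "\<dots> = (\<Sum>x\<in>PiE K X. \<Sum>y\<in>PiE K X. \<Sum>a\<in>X i. \<Sum>b\<in>X i.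
      w i a * W x * (w i b * W y * f (x(i := a)) (y(i := b))))"
    by (simp add: sum_distrib_left ac_simps)
  also have "\<dots> = (\<Sum>x\<in>PiE K X. \<Sum>a\<in>X i. \<Sum>y\<in>PiE K X. \<Sum>b\<in>X i.
      w i a * W x * (w i b * W y * f (x(i := a)) (y(i := b))))"
    by (intro sum.cong[OF refl] sum.swap)
  also have "\<dots> = (\<Sum>a\<in>X i. \<Sum>x\<in>PiE K X. \<Sum>b\<in>X i. \<Sum>y\<in>PiE K X.
      w i a * W x * (w i b * W y * f (x(i := a)) (y(i := b))))"
    by (subst sum.swap) (intro sum.cong[OF refl] sum.swap)
  also have "\<dots> = (\<Sum>a\<in>X i. \<Sum>x\<in>PiE K X. w i a * W x * (\<Sum>y\<in>PiE (insert i K) X.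
      (\<Prod>j\<in>insert i K. w j (y j)) * f (x(i := a)) y))"
    unfolding sum_PiE_insert_product_weight[OF insert.hyps, where w = w] W_def
    by (simp only: sum_distrib_left)
  also have "\<dots> = (\<Sum>x\<in>PiE (insert i K) X. (\<Prod>j\<in>insert i K. w j (x j)) *
      (\<Sum>y\<in>PiE (insert i K) X. (\<Prod>j\<in>insert i K. w j (y j)) * f x y))"
    unfolding sum_PiE_insert_product_weight[OF insert.hyps, where w = w] W_def ..
  also have "\<dots> = (\<Sum>x\<in>PiE (insert i K) X. \<Sum>y\<in>PiE (insert i K) X.
      (\<Prod>j\<in>insert i K. w j (x j)) * (\<Prod>j\<in>insert i K. w j (y j)) * f x y)"
    by (simp only: sum_distrib_left mult.assoc)
  finally show ?case .
qed

section \<open>Families of pairs of disjoint sets\<close>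

definition jointly_open ::
    "('i set \<times> 'i set) set \<Rightarrow> ('i \<Rightarrow> bool) \<Rightarrow> ('i \<Rightarrow> bool) \<Rightarrow> bool" where
  "jointly_open F x y \<longleftrightarrow> (\<exists>(I, J)\<in>F. (\<forall>i\<in>I. x i) \<and> (\<forall>i\<in>J. y i))"

lemma jointly_open_mono:
  assumes "jointly_open F x y" "x \<le> x'" "y \<le> y'"
  shows "jointly_open F x' y'"
  using assms unfolding jointly_open_def le_fun_def le_bool_def by blast

text \<open>
  Since \<open>i\<close> belongs to at most one of the two sets of a pair, one of the two arguments may be set
  to 0 there without losing the pair.
\<close>

lemma jointly_open_close_one:
  assumes disjoint: "\<And>I J. (I, J) \<in> F \<Longrightarrow> I \<inter> J = {}"
    and "jointly_open F (x(i := True)) (y(i := True))"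
  shows "jointly_open F (x(i := True)) (y(i := False)) \<or>
         jointly_open F (x(i := False)) (y(i := True))"
proof -
  obtain I J where IJ: "(I, J) \<in> F" "\<forall>k\<in>I. (x(i := True)) k" "\<forall>k\<in>J. (y(i := True)) k"
    using assms(2) unfolding jointly_open_def by blast
  consider "i \<notin> I" | "i \<notin> J" using disjoint[OF IJ(1)] by blast
  then show ?thesis
  proof cases
    case 1
    then have "\<forall>k\<in>I. (x(i := False)) k" using IJ(2) by auto
    then show ?thesis using IJ unfolding jointly_open_def by blast
  next
    case 2
    then have "\<forall>k\<in>J. (y(i := False)) k" using IJ(3) by auto
    then show ?thesis using IJ unfolding jointly_open_def by blast
  qed
qed

lemma jointly_open_exchange:
  fixes x y :: "'i \<Rightarrow> bool"
  assumes disjoint: "\<And>I J. (I, J) \<in> F \<Longrightarrow> I \<inter> J = {}"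
  defines "f \<equiv> \<lambda>x y. of_bool (jointly_open F x y) :: real"
  shows "f (x(i := a)) (y(i := a)) + f (x(i := b)) (y(i := b))
       \<le> f (x(i := a)) (y(i := b)) + f (x(i := b)) (y(i := a))"
proof -
  have up: "z(i := False) \<le> z(i := c)" for z :: "'i \<Rightarrow> bool" and c
    by (simp add: le_fun_def)
  let ?R = "\<lambda>c d. jointly_open F (x(i := c)) (y(i := d))"
  have "?R False False \<Longrightarrow> ?R c d" for c d
    by (erule jointly_open_mono) (rule up)+
  moreover have "?R True True \<Longrightarrow> ?R True False \<or> ?R False True"
    by (rule jointly_open_close_one[OF disjoint])
  ultimately show ?thesis
    unfolding f_def by (cases a; cases b) (auto simp: of_bool_def)
qed

section \<open>Witnesses of increasing events\<close>

text \<open>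
  The point that agrees with \<open>x\<close> on \<open>I\<close> and with \<open>z\<close> elsewhere lies in \<open>A\<close>, as \<open>I\<close> is a witness,
  and below \<open>z\<close>, as \<open>z\<close> is 1 wherever \<open>x\<close> is 1 on \<open>I\<close>.
\<close>

lemma witness_restrict_to_ones:
  assumes "increasing_event n A" "x \<in> cube n" "witness n A x I"
    and z: "z \<in> cube n" "\<forall>i\<in>{i\<in>I. x i}. z i"
  shows "z \<in> A"
proof -
  define y where "y = (\<lambda>i. if i \<in> I then x i else z i)"
  have y: "y \<in> cube n"
    using assms(2) z(1) unfolding y_def cube_def PiE_def extensional_def by auto
  then have "y \<in> A"
    using assms(3) unfolding witness_def by (simp add: y_def)
  have "y \<le> z" using z(2) unfolding y_def le_fun_def by auto
  then have "indicat_real A y \<le> indicat_real A z"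
    using assms(1) y z(1) unfolding increasing_event_def by (auto dest: mono_onD)
  then show ?thesis
    using \<open>y \<in> A\<close> by (simp add: indicator_def of_bool_def split: if_splits)
qed

text \<open>
  A set \<open>I\<close> guarantees \<open>A\<close> if ones on \<open>I\<close> force \<open>A\<close>. Unlike being a witness, this does not depend on
  a point, so one family serves all points of the cube at once.
\<close>

definition disjoint_guarantees ::
    "nat \<Rightarrow> (nat \<Rightarrow> bool) set \<Rightarrow> (nat \<Rightarrow> bool) set \<Rightarrow> (nat set \<times> nat set) set" where
  "disjoint_guarantees n A B =
     {(I, J). I \<inter> J = {} \<and> I \<subseteq> {1..n} \<and> J \<subseteq> {1..n} \<and>
        {z\<in>cube n. \<forall>i\<in>I. z i} \<subseteq> A \<and> {z\<in>cube n. \<forall>i\<in>J. z i} \<subseteq> B}"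

lemma disjoint_testimony_iff:
  assumes A: "increasing_event n A" and B: "increasing_event n B"
    and x: "x \<in> cube n" and y: "y \<in> cube n"
  shows "(x, y) \<in> disjoint_testimony n A B \<longleftrightarrow> jointly_open (disjoint_guarantees n A B) x y"
proof
  assume "(x, y) \<in> disjoint_testimony n A B"
  then obtain I J where IJ: "I \<inter> J = {}" "witness n A x I" "witness n B y J"
    unfolding disjoint_testimony_def by auto
  have "({i\<in>I. x i}, {i\<in>J. y i}) \<in> disjoint_guarantees n A B"
    using witness_restrict_to_ones[OF A x IJ(2)] witness_restrict_to_ones[OF B y IJ(3)] IJ
    unfolding disjoint_guarantees_def witness_def by auto
  then show "jointly_open (disjoint_guarantees n A B) x y"
    unfolding jointly_open_def by (rule bexI[rotated]) auto
next
  assume "jointly_open (disjoint_guarantees n A B) x y"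
  then obtain I J where "I \<inter> J = {}" "\<forall>i\<in>I. x i" "\<forall>i\<in>J. y i" "I \<subseteq> {1..n}" "J \<subseteq> {1..n}"
    "{z\<in>cube n. \<forall>i\<in>I. z i} \<subseteq> A" "{z\<in>cube n. \<forall>i\<in>J. z i} \<subseteq> B"
    unfolding jointly_open_def disjoint_guarantees_def by auto
  then have "I \<inter> J = {}" "witness n A x I" "witness n B y J"
    unfolding witness_def by auto
  moreover from this have "x \<in> A" "y \<in> B"
    using x y unfolding witness_def by auto
  ultimately show "(x, y) \<in> disjoint_testimony n A B"
    unfolding disjoint_testimony_def by blast
qed

lemma disjoint_occurrence_iff:
  "u \<in> disjoint_occurrence n A B \<longleftrightarrow> (u, u) \<in> disjoint_testimony n A B"
  unfolding disjoint_occurrence_def disjoint_testimony_def by auto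

section \<open>The Bernoulli product measure as a finite sum\<close>

abbreviation bernoulli_weight :: "nat \<Rightarrow> real \<Rightarrow> (nat \<Rightarrow> bool) \<Rightarrow> real" where
  "bernoulli_weight n p x \<equiv> \<Prod>i\<in>{1..n}. pmf (bernoulli_pmf p) (x i)"

lemma prob_space_bernoulli_product: "prob_space (bernoulli_product n p)"
  unfolding bernoulli_product_def by (intro prob_space_PiM prob_space_measure_pmf)

lemma measure_bernoulli_product_singleton:
  assumes "x \<in> cube n"
  shows "measure (bernoulli_product n p) {x} = bernoulli_weight n p x"
proof -
  interpret finite_product_prob_space "\<lambda>_. measure_pmf (bernoulli_pmf p)" "{1..n}"
    by unfold_locales auto
  have "{x} = Pi\<^sub>E {1..n} (\<lambda>i. {x i})"
    using assms by (simp add: cube_def PiE_def PiE_singleton[unfolded PiE_def])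
  then show ?thesis
    using finite_measure_PiM_emb[of "\<lambda>i. {x i}"]
    by (simp add: bernoulli_product_def pmf.rep_eq)
qed

lemma measure_bernoulli_product:
  assumes "S \<subseteq> cube n"
  shows "measure (bernoulli_product n p) S
       = (\<Sum>x\<in>cube n. bernoulli_weight n p x * of_bool (x \<in> S))"
proof -
  interpret prob_space "bernoulli_product n p" by (rule prob_space_bernoulli_product)
  have fin: "finite S" using assms finite_cube by (rule finite_subset)
  have "measure (bernoulli_product n p) S = (\<Sum>x\<in>S. measure (bernoulli_product n p) {x})"
    using assms by (intro finite_measure_eq_sum_singleton[OF fin]) (auto simp: sets_bernoulli_product)
  also have "\<dots> = (\<Sum>x\<in>S. bernoulli_weight n p x * of_bool (x \<in> S))"
    using assms by (intro sum.cong) (auto simp: measure_bernoulli_product_singleton)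
  also have "\<dots> = (\<Sum>x\<in>cube n. bernoulli_weight n p x * of_bool (x \<in> S))"
    using assms by (intro sum.mono_neutral_left finite_cube) auto
  finally show ?thesis .
qed

lemma measure_bernoulli_product_pair:
  assumes "S \<subseteq> cube n \<times> cube n"
  shows "measure (bernoulli_product n p \<Otimes>\<^sub>M bernoulli_product n p) S
       = (\<Sum>x\<in>cube n. \<Sum>y\<in>cube n.
            bernoulli_weight n p x * bernoulli_weight n p y * of_bool ((x, y) \<in> S))"
proof -
  let ?M = "bernoulli_product n p"
  interpret prob_space ?M by (rule prob_space_bernoulli_product)
  interpret P: pair_prob_space ?M ?M ..
  have fin: "finite S" using assms finite_cube by (meson finite_SigmaI finite_subset)
  have "measure (?M \<Otimes>\<^sub>M ?M) S = (\<Sum>z\<in>S. measure (?M \<Otimes>\<^sub>M ?M) {z})"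
    using assms by (intro P.finite_measure_eq_sum_singleton[OF fin])
      (auto simp: sets_bernoulli_product_pair)
  also have "\<dots> = (\<Sum>(x, y)\<in>S.
      bernoulli_weight n p x * bernoulli_weight n p y * of_bool ((x, y) \<in> S))"
  proof (rule sum.cong[OF refl])
    fix z assume z: "z \<in> S"
    obtain x y where [simp]: "z = (x, y)" by (cases z)
    have xy: "x \<in> cube n" "y \<in> cube n" using z assms by auto
    have "measure (?M \<Otimes>\<^sub>M ?M) ({x} \<times> {y}) = measure ?M {x} * measure ?M {y}"
      using xy by (simp only: measure_def emeasure_pair_measure_Times
          singleton_sets_bernoulli_product enn2real_mult)
    then show "measure (?M \<Otimes>\<^sub>M ?M) {z} = (case z of (x, y) \<Rightarrow>
        bernoulli_weight n p x * bernoulli_weight n p y * of_bool ((x, y) \<in> S))"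
      using z xy by (simp add: measure_bernoulli_product_singleton)
  qed
  also have "\<dots> = (\<Sum>(x, y)\<in>cube n \<times> cube n.
      bernoulli_weight n p x * bernoulli_weight n p y * of_bool ((x, y) \<in> S))"
    using assms by (intro sum.mono_neutral_left finite_cartesian_product finite_cube) auto
  finally show ?thesis by (simp add: sum.cartesian_product)
qed

section \<open>The inequality\<close>

theorem theorem1p5:
  fixes n :: nat and p :: real and A B :: "(nat \<Rightarrow> bool) set"
  assumes "n \<ge> 1"
    and "0 < p" and "p < 1"
    and "increasing_event n A" and "increasing_event n B"
  shows "measure (bernoulli_product n p) (disjoint_occurrence n A B)
       \<le> measure (bernoulli_product n p \<Otimes>\<^sub>M bernoulli_product n p) (disjoint_testimony n A B)"
proof -
  define F where "F = disjoint_guarantees n A B"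
  have disjoint: "I \<inter> J = {}" if "(I, J) \<in> F" for I J
    using that unfolding F_def disjoint_guarantees_def by auto
  have testimony: "(x, y) \<in> disjoint_testimony n A B \<longleftrightarrow> jointly_open F x y"
    if "x \<in> cube n" "y \<in> cube n" for x y
    unfolding F_def using assms that by (intro disjoint_testimony_iff)
  have sub: "disjoint_occurrence n A B \<subseteq> cube n"
    "disjoint_testimony n A B \<subseteq> cube n \<times> cube n"
    using assms
    unfolding increasing_event_def disjoint_occurrence_def disjoint_testimony_def by auto
  have "measure (bernoulli_product n p) (disjoint_occurrence n A B)
      = (\<Sum>x\<in>cube n. bernoulli_weight n p x * of_bool (jointly_open F x x))"
    unfolding measure_bernoulli_product[OF sub(1)]
    by (intro sum.cong[OF refl]) (simp only: disjoint_occurrence_iff testimony)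
  also have "\<dots> \<le> (\<Sum>x\<in>cube n. \<Sum>y\<in>cube n.
      bernoulli_weight n p x * bernoulli_weight n p y * of_bool (jointly_open F x y))"
    unfolding cube_def
  proof (rule product_sum_diagonal_le)
    show "sum (pmf (bernoulli_pmf p)) UNIV = 1"
      using assms by (simp add: UNIV_bool)
  qed (simp_all only: finite_atLeastAtMost pmf_nonneg jointly_open_exchange[OF disjoint])
  also have "\<dots> = measure (bernoulli_product n p \<Otimes>\<^sub>M bernoulli_product n p)
      (disjoint_testimony n A B)"
    unfolding measure_bernoulli_product_pair[OF sub(2)]
    by (intro sum.cong[OF refl]) (simp only: testimony)
  finally show ?thesis .
qed

end
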